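(* Let $P$ be a poset with $k$ points that is not an antichain, and let $m>1$ be an integer. Then $$e(m,P)<\left(\tfrac34\right)^m(2^m-1)^k=\left(\tfrac34\right)^m e(m,A_k),$$ where $A_k$ is the $k$-element antichain.
   Context: For a finite poset $P$ on $K$ and a finite set $M$ disjoint from $K$ with $|M|=m$, $e(m,P)$ is the number of partial orders on $M\cup K$ inducing $P$ on $K$ whose set of minimal elements is exactly $M$. *)

theory Defs
  imports Complex_Main
begin

text \<open>A poset is a carrier set \<open>K\<close> with a reflexive order relation \<open>P\<close> such that
  \<open>partial_order_on K P\<close>; the pair \<open>(x, y) \<in> P\<close> means \<open>x \<le> y\<close>.\<close>

definition antichain_order :: "'a set \<Rightarrow> 'a rel \<Rightarrow> bool" where
  "antichain_order K P \<longleftrightarrow>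
     partial_order_on K P \<and> (\<forall>x\<in>K. \<forall>y\<in>K. x \<noteq> y \<longrightarrow> (x, y) \<notin> P)"

definition minimal_elements :: "'a set \<Rightarrow> 'a rel \<Rightarrow> 'a set" where
  "minimal_elements A R = {x \<in> A. \<forall>y\<in>A. (y, x) \<in> R \<longrightarrow> y = x}"

text \<open>\<open>num_extensions M K P\<close> is \<open>e(m, P)\<close> for the concrete \<open>m\<close>-element set \<open>M\<close>, which is meant
  to be disjoint from \<open>K\<close>. \<open>Restr R K\<close> is the order induced by \<open>R\<close> on \<open>K\<close>.\<close>

definition num_extensions :: "'a set \<Rightarrow> 'a set \<Rightarrow> 'a rel \<Rightarrow> nat" where
  "num_extensions M K P =
     card {R. partial_order_on (M \<union> K) R \<and> Restr R K = P \<and> minimal_elements (M \<union> K) R = M}"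

end

theory Submission
  imports Defs "HOL-Library.FuncSet"
begin

text \<open>An extension of \<open>P\<close> whose minimal elements are exactly \<open>M\<close> is determined by the map
  sending \<open>x \<in> K\<close> to the set of elements of \<open>M\<close> below \<open>x\<close>; the maps that occur are the
  monotone maps from \<open>P\<close> to the nonempty subsets of \<open>M\<close>. On an antichain all maps are monotone.
  If \<open>a < b\<close> in \<open>P\<close>, then keeping only the constraint \<open>f a \<subseteq> f b\<close> leaves at most
  \<open>(3^m - 2^m) (2^m - 1)^(k - 2)\<close> maps, and \<open>3^m - 2^m < (3/4)^m (2^m - 1)^2\<close> for \<open>m > 1\<close>.\<close>

text \<open>The extensional function space gives each labelling a single representative, so that
  \<open>card\<close> counts labellings of \<open>K\<close> only.\<close>

definition monotone_labellings :: "'a set \<Rightarrow> 'a set \<Rightarrow> 'a rel \<Rightarrow> ('a \<Rightarrow> 'a set) set" where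
  "monotone_labellings M K P =
     {f \<in> K \<rightarrow>\<^sub>E (Pow M - {{}}). \<forall>(x, y) \<in> P. f x \<subseteq> f y}"

definition labelling_order :: "'a set \<Rightarrow> 'a set \<Rightarrow> 'a rel \<Rightarrow> ('a \<Rightarrow> 'a set) \<Rightarrow> 'a rel" where
  "labelling_order M K P f = P \<union> Id_on M \<union> {(u, x). x \<in> K \<and> u \<in> f x}"

text \<open>Finiteness makes the strict part of \<open>R\<close> well-founded. A minimal element of
  the down-set of \<open>x\<close> is minimal in all of \<open>A\<close> by transitivity. This is
  what makes the labels of an extension nonempty.\<close>

lemma exists_minimal_element_below:
  assumes "finite A" and R: "partial_order_on A R" and "x \<in> A"
  shows "\<exists>u \<in> minimal_elements A R. (u, x) \<in> R"
proof -
  have sub: "R \<subseteq> A \<times> A" and refl: "refl_on A R" and tr: "trans R" and as: "antisym R"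
    using R by (auto simp: order_on_defs)
  have fin: "finite R"
    using finite_subset[OF sub] \<open>finite A\<close> by simp
  have "acyclic (R - Id)"
  proof (rule acyclicI, rule allI)
    fix y
    have "trans (R - Id)" using tr as by (rule trans_diff_Id)
    then show "(y, y) \<notin> (R - Id)\<^sup>+" by simp
  qed
  then have "wf (R - Id)" using fin by (simp add: finite_acyclic_wf)
  moreover have "x \<in> {y \<in> A. (y, x) \<in> R}" using \<open>x \<in> A\<close> refl by (simp add: refl_on_def)
  ultimately obtain u where u: "u \<in> {y \<in> A. (y, x) \<in> R}"
    and min: "\<And>y. (y, u) \<in> R - Id \<Longrightarrow> y \<notin> {y \<in> A. (y, x) \<in> R}"
    by (rule wfE_min) blast
  have "u \<in> minimal_elements A R"
    unfolding minimal_elements_def using u min tr by (blast dest: transD)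
  then show ?thesis using u by blast
qed

lemma labelling_of_extension:
  assumes "finite M" "finite K" "M \<inter> K = {}"
    and R: "partial_order_on (M \<union> K) R" and restr: "Restr R K = P"
    and min: "minimal_elements (M \<union> K) R = M"
  defines "f \<equiv> \<lambda>x\<in>K. {u \<in> M. (u, x) \<in> R}"
  shows "f \<in> monotone_labellings M K P" and "labelling_order M K P f = R"
proof -
  have sub: "R \<subseteq> (M \<union> K) \<times> (M \<union> K)" and refl: "\<And>y. y \<in> M \<union> K \<Longrightarrow> (y, y) \<in> R" and tr: "trans R"
    using R by (auto simp: order_on_defs refl_on_def)
  have nonempty: "\<exists>u \<in> M. (u, x) \<in> R" if "x \<in> K" for x
    using exists_minimal_element_below[OF _ R, of x] assms that by auto
  have "\<forall>(x, y) \<in> P. f x \<subseteq> f y"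
  proof safe
    fix x y u
    assume "(x, y) \<in> P" "u \<in> f x"
    then have "x \<in> K" "y \<in> K" "(x, y) \<in> R" "u \<in> M" "(u, x) \<in> R"
      using restr by (auto simp: f_def split: if_splits)
    then show "u \<in> f y"
      using transD[OF tr, of u x y] by (simp add: f_def)
  qed
  then show "f \<in> monotone_labellings M K P"
    using nonempty by (auto simp: monotone_labellings_def f_def)
  \<comment> \<open>Nothing lies strictly below a point of \<open>M\<close>, so besides the pairs
    inside \<open>K\<close> and the diagonal of \<open>M\<close>, \<open>R\<close> has only pairs
    from \<open>M\<close> to \<open>K\<close>, and these are recorded by \<open>f\<close>.\<close>
  have minD: "y = u" if "u \<in> M" "(y, u) \<in> R" for u y
    using that min subsetD[OF sub that(2)] unfolding minimal_elements_def by blast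
  show "labelling_order M K P f = R"
  proof (rule set_eqI, clarify)
    fix u v
    show "(u, v) \<in> labelling_order M K P f \<longleftrightarrow> (u, v) \<in> R"
      unfolding labelling_order_def f_def restr[symmetric]
      using subsetD[OF sub, of "(u, v)"] refl[of v] minD[of v u] by auto
  qed
qed

text \<open>Label pairs run from \<open>M\<close> to \<open>K\<close> and no pair runs back, which
  gives antisymmetry. In transitivity the only mixed chain is a label pair followed by a pair of
  \<open>P\<close>, and monotonicity covers it. Nonempty labels keep points of \<open>K\<close> from
  being minimal.\<close>

lemma extension_of_labelling:
  assumes disj: "M \<inter> K = {}" and P: "partial_order_on K P"
    and f: "f \<in> monotone_labellings M K P"
  defines "R \<equiv> labelling_order M K P f"
  shows "partial_order_on (M \<union> K) R" and "Restr R K = P"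
    and "minimal_elements (M \<union> K) R = M" and "(\<lambda>x\<in>K. {u \<in> M. (u, x) \<in> R}) = f"
proof -
  have sub: "P \<subseteq> K \<times> K" and refl: "\<And>y. y \<in> K \<Longrightarrow> (y, y) \<in> P" and tr: "trans P" and as: "antisym P"
    using P by (auto simp: order_on_defs refl_on_def)
  have fM: "\<And>x. x \<in> K \<Longrightarrow> f x \<subseteq> M" "\<And>x. x \<in> K \<Longrightarrow> f x \<noteq> {}"
    and mono: "\<And>x y. (x, y) \<in> P \<Longrightarrow> f x \<subseteq> f y" and ext: "f \<in> extensional K"
    using f by (auto simp: monotone_labellings_def PiE_def)
  have iff: "(u, v) \<in> R \<longleftrightarrow> (u, v) \<in> P \<or> (u = v \<and> u \<in> M) \<or> (v \<in> K \<and> u \<in> f v)" for u v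
    by (auto simp: R_def labelling_order_def)
  have "trans R"
  proof (rule transI)
    fix u v w
    assume "(u, v) \<in> R" "(v, w) \<in> R"
    then show "(u, w) \<in> R"
      unfolding iff
      using subsetD[OF sub, of "(u, v)"] subsetD[OF sub, of "(v, w)"] fM(1)[of v] fM(1)[of w]
        mono[of v w] disj transD[OF tr, of u v w] by auto
  qed
  moreover have "antisym R"
  proof (rule antisymI)
    fix u v
    assume "(u, v) \<in> R" "(v, u) \<in> R"
    then show "u = v"
      unfolding iff
      using subsetD[OF sub, of "(u, v)"] subsetD[OF sub, of "(v, u)"] fM(1)[of u] fM(1)[of v]
        disj antisymD[OF as, of u v] by auto
  qed
  moreover have "R \<subseteq> (M \<union> K) \<times> (M \<union> K)" "refl_on (M \<union> K) R"
  proof -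
    show "R \<subseteq> (M \<union> K) \<times> (M \<union> K)"
    proof clarify
      fix u v
      assume "(u, v) \<in> R"
      then show "u \<in> M \<union> K \<and> v \<in> M \<union> K"
        using subsetD[OF sub, of "(u, v)"] fM(1)[of v] by (auto simp: iff)
    qed
    show "refl_on (M \<union> K) R"
      using refl by (auto simp: iff refl_on_def)
  qed
  ultimately show "partial_order_on (M \<union> K) R"
    by (simp add: order_on_defs)
  show "Restr R K = P"
  proof (rule set_eqI, clarify)
    fix u v
    show "(u, v) \<in> Restr R K \<longleftrightarrow> (u, v) \<in> P"
      using subsetD[OF sub, of "(u, v)"] fM(1)[of v] disj by (auto simp: iff)
  qed
  have "u \<in> minimal_elements (M \<union> K) R" if "u \<in> M" for u
    using that sub disj unfolding minimal_elements_def iff by blast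
  moreover have "v \<notin> minimal_elements (M \<union> K) R" if "v \<in> K" for v
    using that fM[OF that] disj unfolding minimal_elements_def iff by blast
  ultimately show "minimal_elements (M \<union> K) R = M"
    by (auto simp: minimal_elements_def)
  \<comment> \<open>Outside \<open>K\<close> both sides are \<open>undefined\<close>, because
    \<open>f\<close> is extensional.\<close>
  show "(\<lambda>x\<in>K. {u \<in> M. (u, x) \<in> R}) = f"
  proof
    fix x
    show "(\<lambda>x\<in>K. {u \<in> M. (u, x) \<in> R}) x = f x"
      using sub disj fM(1)[of x] extensional_arb[OF ext, of x]
      by (cases "x \<in> K") (auto simp: iff)
  qed
qed

lemma num_extensions_eq_card_monotone_labellings:
  assumes "finite M" "finite K" "M \<inter> K = {}" "partial_order_on K P"
  shows "num_extensions M K P = card (monotone_labellings M K P)"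
  unfolding num_extensions_def
proof (rule bij_betw_same_card)
  show "bij_betw (\<lambda>R. \<lambda>x\<in>K. {u \<in> M. (u, x) \<in> R})
    {R. partial_order_on (M \<union> K) R \<and> Restr R K = P \<and> minimal_elements (M \<union> K) R = M}
    (monotone_labellings M K P)"
    (is "bij_betw ?g ?E ?F")
  proof (rule bij_betw_byWitness[where f' = "labelling_order M K P"])
    show "\<forall>R\<in>?E. labelling_order M K P (?g R) = R"
      using labelling_of_extension(2)[OF assms(1-3)] by blast
    show "\<forall>f\<in>?F. ?g (labelling_order M K P f) = f"
      using extension_of_labelling(4)[OF assms(3,4)] by blast
    show "?g ` ?E \<subseteq> ?F"
      using labelling_of_extension(1)[OF assms(1-3)] by blast
    show "labelling_order M K P ` ?F \<subseteq> ?E"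
      using extension_of_labelling(1-3)[OF assms(3,4)] by blast
  qed
qed

lemma card_nonempty_Pow:
  assumes "finite M"
  shows "card (Pow M - {{}}) = 2 ^ card M - 1"
  using assms by (simp add: card_Diff_singleton card_Pow)

lemma num_extensions_antichain:
  assumes "finite M" "finite K" "M \<inter> K = {}" and P: "antichain_order K P"
  shows "num_extensions M K P = (2 ^ card M - 1) ^ card K"
proof -
  have PO: "partial_order_on K P"
    using P by (simp add: antichain_order_def)
  then have "P \<subseteq> K \<times> K" by (simp add: order_on_defs)
  then have "x = y" if "(x, y) \<in> P" for x y
    using P that by (auto simp: antichain_order_def)
  then have "monotone_labellings M K P = K \<rightarrow>\<^sub>E (Pow M - {{}})"
    by (auto simp: monotone_labellings_def)
  then show ?thesis
    using assms(1-3) PO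
    by (simp add: num_extensions_eq_card_monotone_labellings card_funcsetE card_nonempty_Pow
        del: card_Diff_insert)
qed

text \<open>Expand the product of \<open>2 + 1\<close> over \<open>M\<close>: the summand for
  \<open>B\<close> takes the factor 2 exactly at the points of \<open>B\<close>.\<close>

lemma sum_power_two_card_Pow:
  assumes "finite M"
  shows "(\<Sum>B\<in>Pow M. 2 ^ card B) = (3 :: nat) ^ card M"
  using prod_add[OF assms, of "\<lambda>_. 2 :: nat" "\<lambda>_. 1"] by simp

lemma card_nonempty_subset_pairs:
  assumes "finite M"
  shows "card (SIGMA B:Pow M. Pow B - {{}}) = 3 ^ card M - 2 ^ card M"
proof -
  have "card (SIGMA B:Pow M. Pow B - {{}}) = (\<Sum>B\<in>Pow M. 2 ^ card B - 1)"
    using assms finite_subset[OF _ assms]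
    by (simp add: card_SigmaI card_nonempty_Pow del: card_Diff_insert)
  \<comment> \<open>Truncated subtraction splits over the sum because every term
    \<open>2 ^ card B\<close> is at least 1.\<close>
  also have "\<dots> = (\<Sum>B\<in>Pow M. 2 ^ card B) - (\<Sum>B\<in>Pow M. 1)"
    by (rule sum_subtractf_nat) simp
  finally show ?thesis
    using assms by (simp add: sum_power_two_card_Pow card_Pow)
qed

lemma card_monotone_labellings_le:
  assumes "finite M" "finite K" "a \<in> K" "b \<in> K" "a \<noteq> b" "(a, b) \<in> P"
  shows "card (monotone_labellings M K P)
    \<le> (3 ^ card M - 2 ^ card M) * (2 ^ card M - 1) ^ (card K - 2)"
proof -
  let ?K = "K - {a, b}"
  let ?T = "(SIGMA B:Pow M. Pow B - {{}}) \<times> (?K \<rightarrow>\<^sub>E (Pow M - {{}}))"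
  \<comment> \<open>The larger set \<open>f b\<close> comes first, since in the \<open>SIGMA\<close>
    the range of the second component depends on the first.\<close>
  let ?g = "\<lambda>f. ((f b, f a), restrict f ?K)"
  have "inj_on ?g (monotone_labellings M K P)"
  proof (rule inj_onI)
    fix f h
    assume f: "f \<in> monotone_labellings M K P" and h: "h \<in> monotone_labellings M K P"
      and eq: "?g f = ?g h"
    have "restrict f ?K x = restrict h ?K x" for x
      using eq by simp
    then have "f x = h x" if "x \<in> ?K" for x
      using that by (metis restrict_apply')
    moreover have "f a = h a" "f b = h b"
      using eq by simp_all
    ultimately have "f x = h x" if "x \<in> K" for x
      using that by (cases "x = a \<or> x = b") auto
    then show "f = h"
      using f h by (auto simp: monotone_labellings_def intro: PiE_ext)
  qed
  moreover have "?g ` monotone_labellings M K P \<subseteq> ?T"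
  proof (rule image_subsetI)
    fix f assume "f \<in> monotone_labellings M K P"
    then have "f \<in> K \<rightarrow>\<^sub>E (Pow M - {{}})" "f a \<subseteq> f b"
      using assms by (auto simp: monotone_labellings_def)
    then show "?g f \<in> ?T"
      using PiE_mem[of f K "\<lambda>_. Pow M - {{}}"] \<open>a \<in> K\<close> \<open>b \<in> K\<close>
      by (simp add: Pi_iff)
  qed
  moreover have "finite ?T"
  proof -
    have "finite (SIGMA B:Pow M. Pow B - {{}})"
      using assms(1) by (intro finite_SigmaI) (auto intro: finite_subset)
    then show ?thesis
      using assms by (intro finite_cartesian_product finite_PiE) auto
  qed
  ultimately have "card (monotone_labellings M K P) \<le> card ?T"
    by (rule card_inj_on_le)
  also have "card ?T = (3 ^ card M - 2 ^ card M) * (2 ^ card M - 1) ^ card ?K"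
    using assms by (simp add: card_cartesian_product card_nonempty_subset_pairs card_funcsetE
        card_nonempty_Pow del: card_Diff_insert)
  also have "card ?K = card K - 2"
    using assms by (simp add: card_Diff_subset)
  finally show ?thesis .
qed

text \<open>With \<open>q = (3/4)^m\<close>, expanding the square and using
  \<open>q * 4^m = 3^m\<close> reduces the claim to \<open>2 * q * 2^m - q < 2^m\<close>. This is
  clear once \<open>q < 1/2\<close>, that is, for \<open>m\<close> at least 3. It fails at
  \<open>m = 1\<close>.\<close>

lemma three_power_minus_two_power_less:
  assumes "m > 1"
  shows "(3 :: real) ^ m - 2 ^ m < (3 / 4) ^ m * (2 ^ m - 1)\<^sup>2"
proof -
  define q :: real where "q = (3 / 4) ^ m"
  have q3: "q * (2 ^ m)\<^sup>2 = 3 ^ m"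
    by (simp add: q_def power2_eq_square flip: power_mult_distrib)
  have "2 * q * 2 ^ m - q < 2 ^ m"
  \<comment> \<open>Here \<open>q = 9/16\<close> exceeds 1/2, so the term \<open>- q\<close> is
    essential: the left side is 63/16, just below 4.\<close>
  proof (cases "m = 2")
    case True
    then show ?thesis by (simp add: q_def power2_eq_square)
  next
    case False
    then have "q \<le> (3 / 4) ^ 3"
      unfolding q_def using assms by (intro power_decreasing) auto
    \<comment> \<open>The bound is \<open>27/64 < 1/2\<close>.\<close>
    then have "2 * q < 1" by (simp add: power3_eq_cube)
    then have "2 * q * 2 ^ m < 1 * 2 ^ m" by (intro mult_strict_right_mono) auto
    moreover have "q > 0" by (simp add: q_def)
    ultimately show ?thesis by linarith
  qed
  moreover have "q * (2 ^ m - 1)\<^sup>2 = q * (2 ^ m)\<^sup>2 - 2 * q * 2 ^ m + q"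
    by (simp add: power2_eq_square algebra_simps)
  ultimately show ?thesis
    using q3 by (simp flip: q_def)
qed

theorem theorem6p1:
  fixes K M :: "'a set" and P :: "'a rel"
    and L N :: "'b set" and A :: "'b rel"
    and k m :: nat
  assumes "finite K" and "card K = k" and "partial_order_on K P"
    and "\<not> antichain_order K P"
    and "m > 1"
    and "finite M" and "card M = m" and "M \<inter> K = {}"
    and "finite L" and "card L = k" and "antichain_order L A"
    and "finite N" and "card N = m" and "N \<inter> L = {}"
  shows "real (num_extensions M K P) < (3 / 4) ^ m * (2 ^ m - 1) ^ k \<and>
         (3 / 4) ^ m * (2 ^ m - 1) ^ k = (3 / 4) ^ m * real (num_extensions N L A)"
proof
  obtain a b where ab: "a \<in> K" "b \<in> K" "a \<noteq> b" "(a, b) \<in> P"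
    using assms(3,4) by (auto simp: antichain_order_def)
  \<comment> \<open>Two distinct points force \<open>k\<close> to be at least 2, so the truncated
    \<open>k - 2\<close> is exact.\<close>
  have k: "k = 2 + (k - 2)"
    using card_mono[OF assms(1), of "{a, b}"] ab assms(2) by simp
  have pos: "(2 :: real) ^ m - 1 > 0"
    using \<open>m > 1\<close> by simp
  \<comment> \<open>Needed to turn the natural-number difference \<open>3 ^ m - 2 ^ m\<close> into a
    real one.\<close>
  have le: "(2 :: nat) ^ m \<le> 3 ^ m"
    by (rule power_mono) auto
  have "num_extensions M K P \<le> (3 ^ m - 2 ^ m) * (2 ^ m - 1) ^ (k - 2)"
    using card_monotone_labellings_le[OF \<open>finite M\<close> \<open>finite K\<close> ab] assms
    by (simp add: num_extensions_eq_card_monotone_labellings)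
  then have "real (num_extensions M K P) \<le> real ((3 ^ m - 2 ^ m) * (2 ^ m - 1) ^ (k - 2))"
    by (simp only: of_nat_le_iff)
  also have "\<dots> = (3 ^ m - 2 ^ m) * (2 ^ m - 1) ^ (k - 2)"
    using le by (simp add: of_nat_diff)
  also have "\<dots> < ((3 / 4) ^ m * (2 ^ m - 1)\<^sup>2) * (2 ^ m - 1) ^ (k - 2)"
    using three_power_minus_two_power_less[OF \<open>m > 1\<close>] pos
    by (intro mult_strict_right_mono zero_less_power)
  also have "\<dots> = (3 / 4) ^ m * (2 ^ m - 1) ^ k"
    \<comment> \<open>Only the exponent on the right is rewritten; the first occurrence of
      \<open>k\<close> is the one in \<open>k - 2\<close> on the left.\<close>
    by (subst (2) k) (simp only: power_add mult.assoc)
  finally show "real (num_extensions M K P) < (3 / 4) ^ m * (2 ^ m - 1) ^ k" .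
  show "(3 / 4) ^ m * (2 ^ m - 1) ^ k = (3 / 4) ^ m * real (num_extensions N L A)"
    using num_extensions_antichain[of N L A] assms by (simp add: of_nat_diff)
qed

end
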